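(* Let $n$ be a sufficiently large integer, let $0 < \varepsilon = \varepsilon(n) < 1$ and let $q$ be a positive integer. (i) If $q \geq (1+\varepsilon) n$, then Client has a strategy to ensure that $\mathcal{L}(n,q) \leq c\, \varepsilon^{-2} \ln n$ holds, where $c$ is some absolute constant. (ii) If $q \leq (1-\varepsilon) n$, then Waiter has a strategy to ensure that $\mathcal{L}(n,q) \geq \min\{n, 2\varepsilon n - 2\}$.
   Context: The $(q:1)$ Waiter-Client game on $E(K_n)$ (for a positive integer $q$) is the following two-player perfect information game. In each round, Waiter offers Client exactly $q+1$ edges of the complete graph $K_n$ which have not been claimed before; Client chooses one of these edges, which he keeps, and the remaining $q$ edges are claimed by Waiter. If fewer than $q+1$ unclaimed edges remain, all of them are claimed by Waiter. The game ends when all edges of $K_n$ have been claimed. Client's graph is the graph with vertex set $V(K_n)$ whose edges are all the edges claimed by Client. $\mathcal{L}(n,q)$ denotes the order (number of vertices) of a largest connected component of Client's graph at the end of the $(q:1)$ Waiter-Client game on $E(K_n)$ when Client tries to minimize this quantity, Waiter tries to maximize it, and both follow optimal strategies. *)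

theory Defs
  imports Complex_Main
begin

section \<open>Largest components of a graph\<close>

text \<open>A graph with vertex set \<open>V\<close> is given by its set \<open>E\<close> of edges, an edge being a two-element
  subset of \<open>V\<close>.\<close>

type_synonym edge = "nat set"

definition complete_edges :: "nat \<Rightarrow> edge set" where
  "complete_edges n = {e. e \<subseteq> {..<n} \<and> card e = 2}"

definition connected_rel :: "nat set \<Rightarrow> edge set \<Rightarrow> (nat \<times> nat) set" where
  "connected_rel V E = {(u, v). u \<in> V \<and> v \<in> V \<and> (u, v) \<in> {(x, y). {x, y} \<in> E}\<^sup>*}"

definition components :: "nat set \<Rightarrow> edge set \<Rightarrow> nat set set" where
  "components V E = V // connected_rel V E"

definition largest_component_order :: "nat set \<Rightarrow> edge set \<Rightarrow> nat" where
  "largest_component_order V E = Max (card ` components V E)"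

section \<open>The Waiter-Client game\<close>

text \<open>A history lists the completed rounds in order; a round is the pair of the set of edges
  offered by Waiter and the edge chosen by Client.\<close>

type_synonym history = "(edge set \<times> edge) list"

definition client_edges :: "history \<Rightarrow> edge set" where
  "client_edges h = snd ` set h"

definition unclaimed :: "nat \<Rightarrow> history \<Rightarrow> edge set" where
  "unclaimed n h = complete_edges n - \<Union> (fst ` set h)"

definition legal_offer :: "nat \<Rightarrow> nat \<Rightarrow> history \<Rightarrow> edge set \<Rightarrow> bool" where
  "legal_offer n q h A \<longleftrightarrow> A \<subseteq> unclaimed n h \<and> card A = q + 1"

text \<open>A strategy may depend on the whole history. It is also constrained at histories that are not
  reachable in a play; this is harmless, as every strategy can be extended there.\<close>

type_synonym waiter_strategy = "history \<Rightarrow> edge set"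
type_synonym client_strategy = "history \<Rightarrow> edge set \<Rightarrow> edge"

definition waiter_strategies :: "nat \<Rightarrow> nat \<Rightarrow> waiter_strategy set" where
  "waiter_strategies n q =
    {\<tau>. \<forall>h. q + 1 \<le> card (unclaimed n h) \<longrightarrow> legal_offer n q h (\<tau> h)}"

definition client_strategies :: "nat \<Rightarrow> nat \<Rightarrow> client_strategy set" where
  "client_strategies n q = {\<sigma>. \<forall>h A. legal_offer n q h A \<longrightarrow> \<sigma> h A \<in> A}"

primrec play :: "nat \<Rightarrow> nat \<Rightarrow> client_strategy \<Rightarrow> waiter_strategy \<Rightarrow> nat \<Rightarrow> history" where
  "play n q \<sigma> \<tau> 0 = []"
| "play n q \<sigma> \<tau> (Suc k) =
    (let h = play n q \<sigma> \<tau> k in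
     if q + 1 \<le> card (unclaimed n h) then h @ [(\<tau> h, \<sigma> h (\<tau> h))] else h)"

text \<open>The play is stationary once fewer than \<open>q + 1\<close> edges are unclaimed. Since every round claims
  an edge, this has happened after as many steps as there are edges (lemma \<open>play_finished\<close>
  below). The edges then left over go to Waiter, so they do not affect Client's graph.\<close>

definition final_graph :: "nat \<Rightarrow> nat \<Rightarrow> client_strategy \<Rightarrow> waiter_strategy \<Rightarrow> edge set" where
  "final_graph n q \<sigma> \<tau> = client_edges (play n q \<sigma> \<tau> (card (complete_edges n)))"

definition outcome :: "nat \<Rightarrow> nat \<Rightarrow> client_strategy \<Rightarrow> waiter_strategy \<Rightarrow> nat" where
  "outcome n q \<sigma> \<tau> = largest_component_order {..<n} (final_graph n q \<sigma> \<tau>)"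

text \<open>The value of the game under optimal play. For \<open>n \<ge> 1\<close> all outcomes lie in \<open>{1..n}\<close>, so the
  infimum and the supremum over these natural numbers are attained.\<close>

definition game_value :: "nat \<Rightarrow> nat \<Rightarrow> nat" where
  "game_value n q =
    (INF \<sigma>\<in>client_strategies n q. SUP \<tau>\<in>waiter_strategies n q. outcome n q \<sigma> \<tau>)"

lemma finite_complete_edges: "finite (complete_edges n)"
  by (rule finite_subset[of _ "Pow {..<n}"]) (auto simp: complete_edges_def)

lemma card_unclaimed_play:
  assumes "\<tau> \<in> waiter_strategies n q"
  shows "card (unclaimed n (play n q \<sigma> \<tau> k)) \<le> q \<or>
    card (unclaimed n (play n q \<sigma> \<tau> k)) + k * (q + 1) = card (complete_edges n)"
proof (induction k)
  case 0
  show ?case by (simp add: unclaimed_def)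
next
  case (Suc k)
  define h where "h = play n q \<sigma> \<tau> k"
  show ?case
  proof (cases "q + 1 \<le> card (unclaimed n h)")
    case True
    then have A: "\<tau> h \<subseteq> unclaimed n h" "card (\<tau> h) = q + 1"
      using assms by (auto simp: waiter_strategies_def legal_offer_def)
    have fin: "finite (unclaimed n h)"
      by (simp add: unclaimed_def finite_complete_edges)
    have "unclaimed n (h @ [(\<tau> h, \<sigma> h (\<tau> h))]) = unclaimed n h - \<tau> h"
      by (auto simp: unclaimed_def)
    then have "card (unclaimed n (h @ [(\<tau> h, \<sigma> h (\<tau> h))])) = card (unclaimed n h) - (q + 1)"
      using A fin by (simp add: card_Diff_subset finite_subset)
    then show ?thesis using Suc True by (simp add: h_def[symmetric] Let_def)
  next
    case False
    then show ?thesis by (simp add: h_def[symmetric] Let_def)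
  qed
qed

lemma play_finished:
  assumes "\<tau> \<in> waiter_strategies n q"
  shows "card (unclaimed n (play n q \<sigma> \<tau> (card (complete_edges n)))) \<le> q"
  using card_unclaimed_play[OF assms, of \<sigma> "card (complete_edges n)"] by auto

end

theory Submission
  imports Defs "HOL-Library.Multiset"
begin

text \<open>Waiter grows a single tree on a vertex set \<open>C\<close>. With \<open>f v\<close> free edges between an outside
  vertex \<open>v\<close> and \<open>C\<close>, he offers all free edges between \<open>C\<close> and a set \<open>S\<close> of outside vertices such that \<open>f\<close>
  sums to \<open>q + 1\<close> on \<open>S\<close>. Whichever vertex of \<open>S\<close> then joins \<open>C\<close>, the other vertices of \<open>S\<close> are
  left with one free edge, to the new vertex, and the vertices outside \<open>S\<close> gain one. So the multiset
  of the values of \<open>f\<close> does not depend on Client's choices, and Waiter plays a solitaire on it; he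
  offers one vertex of largest value together with vertices of value 1.

  Client minimises the expected number of fully claimed members of a family of edge sets,
  each free edge being counted as claimed with probability \<open>p = 1 / (q + 1)\<close>. The family consists
  of the trees grown from a vertex by \<open>k\<close> self-avoiding paths, each starting anywhere in the tree
  built so far. Its expected number is about \<open>n (k / \<epsilon>\<^sup>2)\<^sup>k\<close>, as in the tree-graph inequalities
  of percolation, while a component of order \<open>s\<close> contains at least \<open>s\<^sup>k\<close> members, one for
  each sequence of \<open>k\<close> end points; then take \<open>k\<close> about \<open>ln n\<close>.\<close>

section \<open>The solitaire\<close>

text \<open>\<open>p\<close> stands for \<open>q + 1\<close> and \<open>A\<close> for the values of
  the offered vertices. Their sum may exceed \<open>p\<close>, as surplus free edges can be left out
  of the offer. One offered vertex joins the tree, hence \<open>size A - 1\<close>.\<close>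

fun winnable :: "nat \<Rightarrow> nat \<Rightarrow> nat multiset \<Rightarrow> bool" where
  "winnable p 0 M \<longleftrightarrow> True"
| "winnable p (Suc k) M \<longleftrightarrow> (\<exists>A B. M = A + B \<and> p \<le> sum_mset A \<and>
     winnable p k (image_mset Suc B + replicate_mset (size A - 1) 1))"

declare winnable.simps(2) [simp del]

lemma winnable_SucI:
  assumes "p \<le> sum_mset A" "winnable p k (image_mset Suc B + replicate_mset (size A - 1) 1)"
  shows "winnable p (Suc k) (A + B)"
  using assms by (auto simp: winnable.simps(2))

text \<open>The extra vertex is left out of the \<open>k\<close> offers and gains one each time. It
  then has value \<open>x + k\<close>, enough for a last offer consisting of it alone.\<close>

lemma winnable_add_one:
  assumes "winnable p k M" "p \<le> x + k"
  shows "winnable p (Suc k) (add_mset x M)"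
  using assms
proof (induction k arbitrary: M x)
  case 0
  then show ?case using winnable_SucI[of p "{#x#}" 0 M] by simp
next
  case (Suc k)
  then obtain A B where AB: "M = A + B" "p \<le> sum_mset A"
    "winnable p k (image_mset Suc B + replicate_mset (size A - 1) 1)" by (auto simp: winnable.simps(2))
  from Suc.IH[OF AB(3), of "Suc x"] Suc.prems(2)
  have "winnable p (Suc k) (image_mset Suc (add_mset x B) + replicate_mset (size A - 1) 1)"
    by simp
  from winnable_SucI[OF AB(2) this] show ?case using AB(1) by simp
qed

lemma image_mset_Suc_atLeastLessThan: "image_mset Suc (mset_set {a..<b}) = mset_set {Suc a..<Suc b}"
  by (simp add: image_mset_mset_set)

lemma mset_set_atLeastLessThan_left:
  "a < b \<Longrightarrow> mset_set {a..<b} = add_mset a (mset_set {Suc a..<b})"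
proof -
  assume "a < b"
  then have "{a..<b} = insert a {Suc a..<b}" by auto
  then show ?thesis by simp
qed

lemma mset_set_atLeastLessThan_Suc:
  "a \<le> b \<Longrightarrow> mset_set {a..<Suc b} = add_mset b (mset_set {a..<b})"
  by (simp add: atLeastLessThanSuc)

text \<open>Each move offers the top value \<open>r\<close> and all \<open>F\<close> ones. The other
  steps shift up by one, so \<open>r\<close> is again the top, and \<open>F\<close> ones come back;
  only \<open>j\<close> drops.\<close>

lemma winnable_staircase:
  assumes "p \<le> r + F" "j \<le> r"
  shows "winnable p j (mset_set {Suc r - j..<Suc r} + replicate_mset F 1)"
  using assms(2)
proof (induction j)
  case 0
  show ?case by simp
next
  case (Suc j)
  define A where "A = add_mset r (replicate_mset F 1)"
  define B where "B = mset_set {r - j..<r}"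
  have e: "mset_set {Suc r - Suc j..<Suc r} + replicate_mset F 1 = A + B"
    by (simp add: A_def B_def mset_set_atLeastLessThan_Suc)
  have "image_mset Suc B = mset_set {Suc r - j..<Suc r}"
    using Suc.prems by (simp add: B_def Suc_diff_le image_mset_Suc_atLeastLessThan)
  moreover have "p \<le> sum_mset A" "size A - 1 = F"
    using assms(1) by (simp_all add: A_def)
  ultimately show ?case unfolding e using Suc by (intro winnable_SucI) simp_all
qed

text \<open>The multisets met in the first half of the solitaire: Waiter offers the value \<open>t\<close>
  and \<open>s + F\<close> ones, which turns \<open>(s, t)\<close> into \<open>(s - 1, t + 1)\<close>.\<close>

lemma winnable_middle:
  assumes "p \<le> s + t + F" "2 \<le> t"
  shows "winnable p (2 * s + t)
    (replicate_mset (Suc s) t + mset_set {2..<t} + replicate_mset (Suc s + F) 1)"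
  using assms
proof (induction s arbitrary: t)
  case (0 t)
  define A where "A = add_mset t (replicate_mset F 1)"
  \<comment> \<open>One of the ones is held back and extends \<open>{2..<t}\<close> to
    \<open>{1..<t}\<close>. After the shift this is a staircase of \<open>t - 1\<close> steps with
    top \<open>t\<close>.\<close>
  define B where "B = mset_set {1..<t}"
  have e: "replicate_mset (Suc 0) t + mset_set {2..<t} + replicate_mset (Suc 0 + F) 1 = A + B"
    using 0 mset_set_atLeastLessThan_left[of 1 t] by (simp add: A_def B_def numeral_2_eq_2)
  have "image_mset Suc B = mset_set {Suc t - (t - 1)..<Suc t}"
    using 0 by (simp add: B_def image_mset_Suc_atLeastLessThan numeral_2_eq_2)
  moreover have "p \<le> sum_mset A" "size A - 1 = F"
    using 0 by (simp_all add: A_def)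
  moreover have "winnable p (t - 1) (mset_set {Suc t - (t - 1)..<Suc t} + replicate_mset F 1)"
    using 0 by (intro winnable_staircase) auto
  ultimately have "winnable p (Suc (t - 1)) (A + B)"
    by (intro winnable_SucI) simp_all
  then show ?case unfolding e using 0 by simp
next
  case (Suc s t)
  define A where "A = add_mset t (replicate_mset (Suc s + F) 1)"
  define B where "B = replicate_mset (Suc s) t + mset_set {1..<t}"
  have e: "replicate_mset (Suc (Suc s)) t + mset_set {2..<t} + replicate_mset (Suc (Suc s) + F) 1 = A + B"
    using Suc.prems mset_set_atLeastLessThan_left[of 1 t] by (simp add: A_def B_def numeral_2_eq_2)
  have "image_mset Suc B = replicate_mset (Suc s) (Suc t) + mset_set {2..<Suc t}"
    using Suc.prems by (simp add: B_def image_mset_Suc_atLeastLessThan numeral_2_eq_2)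
  moreover have "p \<le> sum_mset A" "size A - 1 = Suc s + F"
    using Suc.prems by (simp_all add: A_def)
  moreover have "winnable p (2 * s + Suc t)
      (replicate_mset (Suc s) (Suc t) + mset_set {2..<Suc t} + replicate_mset (Suc s + F) 1)"
    using Suc.prems by (intro Suc.IH) auto
  ultimately have "winnable p (Suc (2 * s + Suc t)) (A + B)"
    by (intro winnable_SucI) simp_all
  then show ?case unfolding e by simp
qed

text \<open>The first move offers \<open>r + F\<close> ones. It leaves \<open>r - 1\<close> twos and
  \<open>r + F - 1\<close> ones, the position of \<open>winnable_middle\<close> with
  \<open>s = r - 2\<close> and \<open>t = 2\<close>; for \<open>r = 1\<close> no further move is
  asked for.\<close>

lemma winnable_ones:
  assumes "p \<le> r + F" "1 \<le> r"
  shows "winnable p (2 * r - 1) (replicate_mset (2 * r - 1 + F) 1)"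
proof -
  have e: "replicate_mset (2 * r - 1 + F) (1::nat) =
      replicate_mset (r + F) 1 + replicate_mset (r - 1) 1"
    using assms by (intro multiset_eqI) auto
  have "winnable p (2 * r - 2) (replicate_mset (r - 1) 2 + replicate_mset (r + F - 1) 1)"
  proof (cases "r = 1")
    case False
    then have "winnable p (2 * (r - 2) + 2) (replicate_mset (Suc (r - 2)) 2 + mset_set {2..<2}
        + replicate_mset (Suc (r - 2) + F) 1)"
      using assms by (intro winnable_middle) auto
    moreover have "2 * (r - 2) + 2 = 2 * r - 2" "Suc (r - 2) = r - 1" "r - 1 + F = r + F - 1"
      using False assms(2) by auto
    ultimately show ?thesis by simp
  qed simp
  then have "winnable p (Suc (2 * r - 2)) (replicate_mset (r + F) 1 + replicate_mset (r - 1) 1)"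
    using assms by (intro winnable_SucI) (auto simp: sum_mset_replicate_mset numeral_2_eq_2)
  moreover have "Suc (2 * r - 2) = 2 * r - 1" using assms(2) by auto
  ultimately show ?thesis unfolding e by simp
qed

section \<open>Positions from which Waiter wins\<close>

text \<open>Backward induction over exactly \<open>k\<close> further rounds. In this form the
  solitaire can be transferred to the board before any strategy function is built.\<close>

fun forceable :: "nat \<Rightarrow> nat \<Rightarrow> (history \<Rightarrow> bool) \<Rightarrow> nat \<Rightarrow> history \<Rightarrow> bool" where
  "forceable n q P 0 h \<longleftrightarrow> P h"
| "forceable n q P (Suc k) h \<longleftrightarrow>
     (\<exists>A. legal_offer n q h A \<and> (\<forall>e\<in>A. forceable n q P k (h @ [(A, e)])))"

lemma finite_unclaimed: "finite (unclaimed n h)"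
  by (simp add: unclaimed_def finite_complete_edges)

lemma ex_legal_offer: "q + 1 \<le> card (unclaimed n h) \<Longrightarrow> \<exists>A. legal_offer n q h A"
  by (metis legal_offer_def obtain_subset_with_card_n)

lemma legal_offer_card: "legal_offer n q h A \<Longrightarrow> q + 1 \<le> card (unclaimed n h)"
  by (metis card_mono finite_unclaimed legal_offer_def)

lemma waiter_strategies_nonempty: "waiter_strategies n q \<noteq> {}"
proof -
  have "(\<lambda>h. SOME A. legal_offer n q h A) \<in> waiter_strategies n q"
    unfolding waiter_strategies_def by (blast intro: someI_ex ex_legal_offer)
  then show ?thesis by blast
qed

lemma client_strategies_nonempty: "client_strategies n q \<noteq> {}"
proof -
  have "(\<lambda>h A. SOME e. e \<in> A) \<in> client_strategies n q"
    unfolding client_strategies_def legal_offer_def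
    by clarify (metis Suc_eq_plus1 card.empty nat.distinct(1) some_in_eq)
  then show ?thesis by blast
qed

text \<open>The length of the history tells how many rounds of the plan remain, so the good offers
  can be chosen as a function of the history. After \<open>K\<close> rounds any legal offers do,
  since \<open>P\<close> persists.\<close>

lemma forceable_imp_strategy:
  assumes "forceable n q P K []" and mono: "\<And>h x. P h \<Longrightarrow> P (h @ [x])"
  shows "\<exists>\<tau>\<in>waiter_strategies n q. \<forall>\<sigma>\<in>client_strategies n q.
    P (play n q \<sigma> \<tau> (card (complete_edges n)))"
proof -
  define good where "good h A \<longleftrightarrow> legal_offer n q h A \<and>
    (\<forall>e\<in>A. forceable n q P (K - Suc (length h)) (h @ [(A, e)]))" for h A
  define \<tau> where "\<tau> h = (if \<exists>A. good h A then SOME A. good h A else SOME A. legal_offer n q h A)" for h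
  have legal: "legal_offer n q h (\<tau> h)" if "q + 1 \<le> card (unclaimed n h)" for h
    using ex_legal_offer[OF that] someI_ex[of "good h"] someI_ex[of "legal_offer n q h"]
    by (auto simp: \<tau>_def good_def)
  have \<tau>: "\<tau> \<in> waiter_strategies n q" using legal by (auto simp: waiter_strategies_def)
  have "P (play n q \<sigma> \<tau> (card (complete_edges n)))" if \<sigma>: "\<sigma> \<in> client_strategies n q" for \<sigma>
  proof -
    let ?h = "play n q \<sigma> \<tau>"
    have inv: "length (?h k) = k \<and> forceable n q P (K - k) (?h k)" if "k \<le> K" for k
      using that
    proof (induction k)
      case 0
      show ?case using assms(1) by simp
    next
      case (Suc k)
      then have len: "length (?h k) = k" and f: "forceable n q P (Suc (K - Suc k)) (?h k)"
        by (auto simp: Suc_diff_Suc)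
      from f obtain A where A: "good (?h k) A" by (auto simp: good_def len)
      then have g: "good (?h k) (\<tau> (?h k))" by (metis \<tau>_def someI_ex)
      then have c: "q + 1 \<le> card (unclaimed n (?h k))"
        using legal_offer_card good_def by blast
      have "\<sigma> (?h k) (\<tau> (?h k)) \<in> \<tau> (?h k)"
        using g \<sigma> by (auto simp: good_def client_strategies_def)
      moreover have "?h (Suc k) = ?h k @ [(\<tau> (?h k), \<sigma> (?h k) (\<tau> (?h k)))]"
        using c by (simp add: Let_def)
      ultimately show ?case using g len unfolding good_def by simp
    qed
    let ?N = "card (complete_edges n)"
    \<comment> \<open>Otherwise a legal offer would be promised at a time when at most
      \<open>q\<close> edges are free.\<close>
    have "K \<le> ?N"
    proof (rule ccontr)
      assume "\<not> K \<le> ?N"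
      then have "forceable n q P (Suc (K - Suc ?N)) (?h ?N)"
        using inv[of ?N] by (auto simp: Suc_diff_Suc)
      then show False using legal_offer_card play_finished[OF \<tau>, of \<sigma>] by fastforce
    qed
    moreover have "P (?h K)" using inv[of K] by simp
    ultimately show ?thesis
      by (induction rule: dec_induct) (auto simp: Let_def mono)
  qed
  then show ?thesis using \<tau> by blast
qed

section \<open>Playing the solitaire on the board\<close>

definition linked :: "edge set \<Rightarrow> (nat \<times> nat) set" where
  "linked E = {(x, y). {x, y} \<in> E}"

lemma linked_mono: "E \<subseteq> E' \<Longrightarrow> linked E \<subseteq> linked E'"
  by (auto simp: linked_def)

lemma sym_linked: "sym (linked E)"
  by (auto simp: linked_def sym_def insert_commute)

text \<open>Asking only for \<open>m\<close> vertices inside one component, not for a whole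
  component, makes the property survive later rounds.\<close>

definition has_connected_set :: "nat \<Rightarrow> nat \<Rightarrow> history \<Rightarrow> bool" where
  "has_connected_set n m h \<longleftrightarrow> (\<exists>C\<subseteq>{..<n}. card C = m \<and> C \<times> C \<subseteq> (linked (client_edges h))\<^sup>*)"

lemma has_connected_set_snoc: "has_connected_set n m h \<Longrightarrow> has_connected_set n m (h @ [x])"
proof -
  have "client_edges h \<subseteq> client_edges (h @ [x])" by (auto simp: client_edges_def)
  then have "(linked (client_edges h))\<^sup>* \<subseteq> (linked (client_edges (h @ [x])))\<^sup>*"
    by (intro rtrancl_mono linked_mono)
  moreover assume "has_connected_set n m h"
  then obtain C where "C \<subseteq> {..<n}" "card C = m" "C \<times> C \<subseteq> (linked (client_edges h))\<^sup>*"
    unfolding has_connected_set_def by blast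
  ultimately show ?thesis unfolding has_connected_set_def by (intro exI[of _ C]) blast
qed

lemma mset_set_set_mset_if_subseteq:
  assumes "A \<subseteq># mset_set S"
  shows "mset_set (set_mset A) = A"
proof (rule multiset_eqI)
  fix x
  have "count A x \<le> count (mset_set S) x"
    using assms by (rule mset_subset_eq_count)
  also have "\<dots> \<le> 1" by (simp add: count_mset_set')
  finally have "count A x \<le> 1" .
  moreover have "x \<in># A \<longleftrightarrow> 0 < count A x" by simp
  ultimately show "count (mset_set (set_mset A)) x = count A x"
    by (auto simp add: count_mset_set' simp del: count_greater_zero_iff)
qed

text \<open>\<open>D v\<close> is a set of free edges between \<open>v\<close> and \<open>C\<close>, not always all of them: when the values in
  \<open>S\<close> sum to more than \<open>q + 1\<close>, the edges that are not offered are forgotten.\<close>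

lemma forceable_if_winnable:
  assumes "winnable (q + 1) k M"
    and "C \<subseteq> {..<n}" "C \<times> C \<subseteq> (linked (client_edges h))\<^sup>*"
    and M: "image_mset (\<lambda>v. card (D v)) (mset_set ({..<n} - C)) = M"
    and D: "\<And>v. v \<in> {..<n} - C \<Longrightarrow> D v \<subseteq> unclaimed n h \<inter> (\<lambda>c. {c, v}) ` C"
    and out: "\<And>u v. u \<in> {..<n} - C \<Longrightarrow> v \<in> {..<n} - C \<Longrightarrow> u \<noteq> v \<Longrightarrow> {u, v} \<in> unclaimed n h"
  shows "forceable n q (has_connected_set n (card C + k)) k h"
  using assms
proof (induction k arbitrary: M C D h)
  case 0
  then show ?case unfolding has_connected_set_def by auto
next
  case (Suc k)
  let ?O = "{..<n} - C"
  note CV = Suc.prems(2) and conn = Suc.prems(3) and D = Suc.prems(5) and out = Suc.prems(6)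
  obtain A B where AB: "M = A + B" "q + 1 \<le> sum_mset A"
    "winnable (q + 1) k (image_mset Suc B + replicate_mset (size A - 1) 1)"
    using Suc.prems(1) by (auto simp: winnable.simps(2))
  \<comment> \<open>The split of the values is pulled back to a split of the outside
    vertices.\<close>
  obtain A' B' where AB': "mset_set ?O = A' + B'" "A = image_mset (\<lambda>v. card (D v)) A'"
    "B = image_mset (\<lambda>v. card (D v)) B'"
    using image_mset_eq_plusD[OF Suc.prems(4)[unfolded AB(1)]] by auto
  define S where "S = set_mset A'"
  have SO: "S \<subseteq> ?O"
    unfolding S_def by (metis AB'(1) elem_mset_set finite_Diff finite_lessThan subsetI union_iff)
  have finS: "finite S" by (simp add: S_def)
  have A': "A' = mset_set S"
    unfolding S_def by (rule sym, rule mset_set_set_mset_if_subseteq[of _ ?O]) (simp add: AB'(1))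
  have B': "B' = mset_set (?O - S)"
    by (metis A' AB'(1) SO add_diff_cancel_left' finite_Diff finite_lessThan mset_set_Diff)
  define X0 where "X0 = (\<Union>v\<in>S. D v)"
  have finC: "finite C" using CV finite_subset by blast
  have finD: "finite (D v)" if "v \<in> S" for v
    using D[of v] SO that finC by (meson finite_imageI finite_Int finite_subset subsetD)
  have disj: "D u \<inter> D v = {}" if "u \<in> ?O" "v \<in> ?O" "u \<noteq> v" for u v
    using D[OF that(1)] D[OF that(2)] that by (fastforce simp: doubleton_eq_iff)
  have "card X0 = (\<Sum>v\<in>S. card (D v))"
    unfolding X0_def using finD disj SO by (intro card_UN_disjoint finS) blast+
  also have "\<dots> = sum_mset A" by (simp add: AB'(2) A' sum_unfold_sum_mset)
  finally obtain X where X: "X \<subseteq> X0" "card X = q + 1"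
    using AB(2) obtain_subset_with_card_n by metis
  have X0U: "X0 \<subseteq> unclaimed n h" using D SO by (fastforce simp: X0_def)
  have "forceable n q (has_connected_set n (card C + Suc k)) k (h @ [(X, e)])" if "e \<in> X" for e
  proof -
    obtain v where v: "v \<in> S" "e \<in> D v" using \<open>e \<in> X\<close> X(1) unfolding X0_def by blast
    obtain c where c: "c \<in> C" "e = {c, v}" using D[of v] v SO by blast
    have vO: "v \<in> ?O" using v SO by blast
    define h' where "h' = h @ [(X, e)]"
    \<comment> \<open>Unchosen vertices of \<open>S\<close> drop whatever is left of their old
      edges, which makes their new value exactly 1.\<close>
    define D' where "D' u = insert {v, u} (if u \<in> S then {} else D u)" for u
    have un: "unclaimed n h' = unclaimed n h - X" by (auto simp: h'_def unclaimed_def)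
    have cl: "client_edges h' = insert e (client_edges h)" by (auto simp: h'_def client_edges_def)
    have O': "{..<n} - insert v C = (?O - S) \<union> (S - {v})" using v SO by auto
    \<comment> \<open>Every offered edge has an end in \<open>C\<close>, so the edges between
      outside vertices stay free.\<close>
    have notX: "{u, w} \<notin> X" if "u \<in> ?O" "w \<in> ?O" for u w
    proof
      assume "{u, w} \<in> X"
      then obtain z where "z \<in> S" "{u, w} \<in> D z" using X by (auto simp: X0_def)
      then obtain c' where "c' \<in> C" "{u, w} = {c', z}" using D[of z] SO by blast
      then show False using that by (auto simp: doubleton_eq_iff)
    qed
    have cardD': "card (D' u) = (if u \<in> S then 1 else Suc (card (D u)))" if "u \<in> ?O" "u \<noteq> v" for u
    proof -
      have "{v, u} \<notin> D u" using D[OF that(1)] that vO by (auto simp: doubleton_eq_iff)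
      moreover have "finite (D u)"
        using D[OF that(1)] finC by (meson finite_imageI finite_Int finite_subset)
      ultimately show ?thesis by (simp add: D'_def)
    qed
    have cardB: "card (D' u) = Suc (card (D u))" if "u \<in> ?O - S" for u
      using that v(1) cardD'[of u] by auto
    have cardA: "card (D' u) = 1" if "u \<in> S - {v}" for u
      using that SO cardD'[of u] by auto
    have "forceable n q (has_connected_set n (card (insert v C) + k)) k h'"
    proof (rule Suc.IH)
      show "winnable (q + 1) k (image_mset Suc B + replicate_mset (size A - 1) 1)" by fact
      show "insert v C \<subseteq> {..<n}" using CV vO by auto
      show "insert v C \<times> insert v C \<subseteq> (linked (client_edges h'))\<^sup>*"
      proof -
        let ?r = "(linked (client_edges h'))\<^sup>*"
        have "C \<times> C \<subseteq> ?r"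
          using conn rtrancl_mono[OF linked_mono, of "client_edges h" "client_edges h'"] cl by blast
        moreover have "(c, v) \<in> ?r" "(v, c) \<in> ?r"
          using c by (auto simp: linked_def cl insert_commute)
        ultimately show ?thesis using c(1) by (auto intro: rtrancl_trans)
      qed
      show "image_mset (\<lambda>u. card (D' u)) (mset_set ({..<n} - insert v C)) =
          image_mset Suc B + replicate_mset (size A - 1) 1"
      proof -
        have "mset_set ({..<n} - insert v C) = mset_set (?O - S) + mset_set (S - {v})"
          unfolding O' by (intro mset_set_Union) (auto simp: finS)
        moreover have "image_mset (\<lambda>u. card (D' u)) (mset_set (?O - S)) = image_mset Suc B"
          unfolding AB'(3) B' multiset.map_comp
          by (intro image_mset_cong) (simp add: cardB)
        moreover have "image_mset (\<lambda>u. card (D' u)) (mset_set (S - {v})) =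
            image_mset (\<lambda>u. 1) (mset_set (S - {v}))"
          using finS by (intro image_mset_cong) (simp add: cardA)
        moreover have "image_mset (\<lambda>u. 1) (mset_set (S - {v})) = replicate_mset (size A - 1) (1::nat)"
          using v(1) finS by (simp add: AB'(2) A' image_mset_const_eq)
        ultimately show ?thesis by simp
      qed
      show "D' u \<subseteq> unclaimed n h' \<inter> (\<lambda>c. {c, u}) ` insert v C" if u: "u \<in> {..<n} - insert v C" for u
      proof -
        have "{v, u} \<in> unclaimed n h'" using u vO out[of v u] notX[of v u] by (auto simp: un)
        moreover have "D u \<subseteq> unclaimed n h' \<inter> (\<lambda>c. {c, u}) ` C" if "u \<notin> S"
        proof -
          have "D u \<inter> X = {}" using X disj[of u] u that SO by (fastforce simp: X0_def)
          then show ?thesis using D[of u] u by (auto simp: un)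
        qed
        ultimately show ?thesis by (auto simp: D'_def)
      qed
      show "{u, w} \<in> unclaimed n h'"
        if "u \<in> {..<n} - insert v C" "w \<in> {..<n} - insert v C" "u \<noteq> w" for u w
        using that out[of u w] notX[of u w] by (auto simp: un)
    qed
    then show ?thesis using vO finC by (simp add: h'_def)
  qed
  moreover have "legal_offer n q h X" using X X0U by (auto simp: legal_offer_def)
  ultimately show ?case unfolding forceable.simps by blast
qed

section \<open>Outcomes and the value of the game\<close>

lemma complete_edges_reach:
  assumes "E \<subseteq> complete_edges n" "(u, v) \<in> (linked E)\<^sup>*" "u < n"
  shows "v < n"
  using assms(2) by (induction rule: rtrancl_induct) (use assms in \<open>auto simp: linked_def complete_edges_def\<close>)

lemma connected_rel_linked:
  "connected_rel V E = {(u, v). u \<in> V \<and> v \<in> V \<and> (u, v) \<in> (linked E)\<^sup>*}"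
  by (simp add: connected_rel_def linked_def)

lemma components_eq:
  assumes "E \<subseteq> complete_edges n"
  shows "components {..<n} E = (\<lambda>v. (linked E)\<^sup>* `` {v}) ` {..<n}"
proof -
  have "connected_rel {..<n} E `` {v} = (linked E)\<^sup>* `` {v}" if "v < n" for v
    using that complete_edges_reach[OF assms] by (auto simp: connected_rel_linked)
  then show ?thesis by (auto simp: components_def quotient_def)
qed

lemma client_edges_play:
  assumes "\<tau> \<in> waiter_strategies n q" "\<sigma> \<in> client_strategies n q"
  shows "client_edges (play n q \<sigma> \<tau> k) \<subseteq> complete_edges n"
proof (induction k)
  case (Suc k)
  let ?h = "play n q \<sigma> \<tau> k"
  have "\<sigma> ?h (\<tau> ?h) \<in> complete_edges n" if "q + 1 \<le> card (unclaimed n ?h)"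
  proof -
    have "legal_offer n q ?h (\<tau> ?h)" using assms that by (auto simp: waiter_strategies_def)
    moreover then have "\<sigma> ?h (\<tau> ?h) \<in> \<tau> ?h" using assms by (auto simp: client_strategies_def)
    ultimately show ?thesis by (auto simp: legal_offer_def unclaimed_def)
  qed
  then show ?case using Suc by (auto simp: Let_def client_edges_def)
qed (simp add: client_edges_def)

lemma outcome_eq:
  assumes "\<tau> \<in> waiter_strategies n q" "\<sigma> \<in> client_strategies n q"
  shows "outcome n q \<sigma> \<tau> = Max ((\<lambda>v. card ((linked (final_graph n q \<sigma> \<tau>))\<^sup>* `` {v})) ` {..<n})"
  using components_eq[of "final_graph n q \<sigma> \<tau>" n] client_edges_play[OF assms]
  by (simp add: outcome_def largest_component_order_def final_graph_def image_image)

lemma card_component_le: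
  assumes "E \<subseteq> complete_edges n" "v < n"
  shows "card ((linked E)\<^sup>* `` {v}) \<le> n"
proof -
  have "(linked E)\<^sup>* `` {v} \<subseteq> {..<n}" using complete_edges_reach[OF assms(1)] assms(2) by auto
  from card_mono[OF _ this] show ?thesis by simp
qed

lemma outcome_le:
  assumes "\<tau> \<in> waiter_strategies n q" "\<sigma> \<in> client_strategies n q" "0 < n"
  shows "outcome n q \<sigma> \<tau> \<le> n"
  using assms(3) client_edges_play[OF assms(1,2)]
  by (subst outcome_eq[OF assms(1,2)], intro Max.boundedI)
    (auto simp: final_graph_def card_component_le)

lemma outcome_ge_connected_set:
  assumes "\<tau> \<in> waiter_strategies n q" "\<sigma> \<in> client_strategies n q" "0 < m"
    and "has_connected_set n m (play n q \<sigma> \<tau> (card (complete_edges n)))"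
  shows "m \<le> outcome n q \<sigma> \<tau>"
proof -
  let ?E = "final_graph n q \<sigma> \<tau>"
  obtain C where C: "C \<subseteq> {..<n}" "card C = m" "C \<times> C \<subseteq> (linked ?E)\<^sup>*"
    using assms(4) by (auto simp: has_connected_set_def final_graph_def)
  obtain v where v: "v \<in> C" using C(2) assms(3) by fastforce
  have E: "?E \<subseteq> complete_edges n" using client_edges_play[OF assms(1,2)] by (simp add: final_graph_def)
  have vn: "v < n" using v C by auto
  have "(linked ?E)\<^sup>* `` {v} \<subseteq> {..<n}" using complete_edges_reach[OF E] vn by auto
  then have "finite ((linked ?E)\<^sup>* `` {v})" by (rule finite_subset) simp
  then have "m \<le> card ((linked ?E)\<^sup>* `` {v})" using C v by (auto intro: card_mono)
  also have "\<dots> \<le> outcome n q \<sigma> \<tau>"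
    unfolding outcome_eq[OF assms(1,2)] using vn by (intro Max_ge) auto
  finally show ?thesis .
qed

lemma game_value_le:
  assumes "\<sigma> \<in> client_strategies n q" "\<And>\<tau>. \<tau> \<in> waiter_strategies n q \<Longrightarrow> real (outcome n q \<sigma> \<tau>) \<le> x"
  shows "real (game_value n q) \<le> x"
proof -
  \<comment> \<open>Outcomes are integers, so the real bound may be rounded down and the infimum
    handled in the naturals. Undoing \<open>nat\<close> at the end takes
    \<open>0 \<le> x\<close>.\<close>
  have *: "outcome n q \<sigma> \<tau> \<le> nat \<lfloor>x\<rfloor>" if "\<tau> \<in> waiter_strategies n q" for \<tau>
    using assms(2)[OF that] by linarith
  have "game_value n q \<le> (SUP \<tau>\<in>waiter_strategies n q. outcome n q \<sigma> \<tau>)"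
    unfolding game_value_def by (rule cINF_lower) (use assms in auto)
  also have "\<dots> \<le> nat \<lfloor>x\<rfloor>" by (rule cSUP_least) (use * waiter_strategies_nonempty in auto)
  finally have "game_value n q \<le> nat \<lfloor>x\<rfloor>" .
  moreover have "0 \<le> x"
    using assms(2) waiter_strategies_nonempty[of n q] by (metis all_not_in_conv of_nat_0_le_iff order_trans)
  ultimately show ?thesis by linarith
qed

lemma game_value_ge:
  assumes "\<tau> \<in> waiter_strategies n q" "0 < n" "\<And>\<sigma>. \<sigma> \<in> client_strategies n q \<Longrightarrow> x \<le> real (outcome n q \<sigma> \<tau>)"
  shows "x \<le> real (game_value n q)"
proof -
  have "nat \<lceil>x\<rceil> \<le> game_value n q"
    unfolding game_value_def
  proof (rule cINF_greatest)
    fix \<sigma> assume \<sigma>: "\<sigma> \<in> client_strategies n q"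
    have "nat \<lceil>x\<rceil> \<le> outcome n q \<sigma> \<tau>" using assms(3)[OF \<sigma>] by linarith
    \<comment> \<open>A supremum of naturals is an upper bound only for a bounded set; here
      \<open>n\<close> is the bound.\<close>
    also have "\<dots> \<le> (SUP \<tau>\<in>waiter_strategies n q. outcome n q \<sigma> \<tau>)"
      using outcome_le[OF _ \<sigma> assms(2)] assms(1) by (intro cSUP_upper) (auto intro!: bdd_aboveI[of _ n])
    finally show "nat \<lceil>x\<rceil> \<le> (SUP \<tau>\<in>waiter_strategies n q. outcome n q \<sigma> \<tau>)" .
  qed (rule client_strategies_nonempty)
  then show ?thesis by linarith
qed

section \<open>Waiter's bound\<close>

lemma waiter_forces_tree:
  assumes "winnable (q + 1) k (replicate_mset (n - 1) 1)" "0 < n"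
  shows "\<exists>\<tau>\<in>waiter_strategies n q. \<forall>\<sigma>\<in>client_strategies n q. Suc k \<le> outcome n q \<sigma> \<tau>"
proof -
  have "{0..<n} - {0} = {..<n} - {0}" by auto
  \<comment> \<open>The initial tree is the vertex 0, to which each of the \<open>n - 1\<close>
    other vertices has one free edge.\<close>
  then have M: "image_mset (\<lambda>v. card {{0, v}}) (mset_set ({..<n} - {0})) = replicate_mset (n - 1) 1"
    using assms(2) by (simp add: image_mset_const_eq)
  have "forceable n q (has_connected_set n (card {0::nat} + k)) k []"
    by (rule forceable_if_winnable[OF assms(1) _ _ M])
      (use assms(2) in \<open>auto simp: unclaimed_def complete_edges_def\<close>)
  from forceable_imp_strategy[OF this has_connected_set_snoc]
  show ?thesis by (metis One_nat_def card.empty card_insert_disjoint empty_iff finite.emptyI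
    outcome_ge_connected_set plus_1_eq_Suc zero_less_Suc)
qed

text \<open>For \<open>n \<le> q + 1\<close> the bound is at most 1 and a single vertex suffices.
  For larger \<open>n\<close> below \<open>2 * (q + 1)\<close>, Waiter gets a tree of order
  \<open>2 * (n - q) - 2\<close>. From \<open>2 * (q + 1)\<close> on he builds a spanning
  tree.\<close>

lemma waiter_bound:
  assumes "0 < n" "real q \<le> (1 - \<epsilon>) * real n"
  shows "\<exists>\<tau>\<in>waiter_strategies n q. \<forall>\<sigma>\<in>client_strategies n q.
    min (real n) (2 * \<epsilon> * real n - 2) \<le> real (outcome n q \<sigma> \<tau>)"
proof -
  let ?b = "min (real n) (2 * \<epsilon> * real n - 2)"
  have b: "\<epsilon> * real n \<le> real n - real q" using assms(2) by (simp add: algebra_simps)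
  have "\<exists>k. ?b \<le> real (Suc k) \<and> winnable (q + 1) k (replicate_mset (n - 1) 1)"
  proof (cases "n \<le> q + 1")
    case True
    then have "?b \<le> real (Suc 0)" using b by linarith
    then show ?thesis by (intro exI[of _ 0]) simp
  next
    case nq: False
    show ?thesis
    proof (cases "2 * (q + 1) \<le> n")
      case False
      \<comment> \<open>The solution of \<open>2 * r - 1 + F = n - 1\<close> and
        \<open>r + F = q + 1\<close>.\<close>
      let ?r = "n - (q + 1)" and ?F = "2 * (q + 1) - n"
      have "winnable (q + 1) (2 * ?r - 1) (replicate_mset (2 * ?r - 1 + ?F) 1)"
        by (rule winnable_ones) (use nq False in auto)
      moreover have "2 * ?r - 1 + ?F = n - 1" using nq False by auto
      moreover have "?b \<le> real (Suc (2 * ?r - 1))" using b nq by (auto simp: of_nat_diff)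
      ultimately show ?thesis by metis
    next
      case True
      let ?r = "n div 2"
      have r: "winnable (q + 1) (2 * ?r - 1) (replicate_mset (2 * ?r - 1 + 0) 1)"
        by (rule winnable_ones) (use True in auto)
      show ?thesis
      proof (cases "even n")
        case True
        then have "2 * ?r = n" by auto
        then show ?thesis using r assms(1) by (intro exI[of _ "n - 1"]) auto
      next
        case odd: False
        then have n: "n = Suc (2 * ?r)" by presburger
        \<comment> \<open>For odd \<open>n\<close> one vertex is left over and is added by an offer
          of its own.\<close>
        have "winnable (q + 1) (Suc (2 * ?r - 1)) (add_mset 1 (replicate_mset (2 * ?r - 1 + 0) 1))"
          by (rule winnable_add_one[OF r]) (use True in auto)
        moreover have e: "Suc (2 * ?r - 1) = n - 1" using True n by (cases "n div 2") auto
        moreover have "add_mset 1 (replicate_mset (2 * ?r - 1 + 0) 1) = replicate_mset (n - 1) (1::nat)"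
          by (metis add_0_right e replicate_mset_Suc)
        ultimately have "winnable (q + 1) (n - 1) (replicate_mset (n - 1) 1)" by metis
        then show ?thesis using assms(1) by (intro exI[of _ "n - 1"]) auto
      qed
    qed
  qed
  then obtain k where k: "?b \<le> real (Suc k)" "winnable (q + 1) k (replicate_mset (n - 1) 1)" by blast
  from waiter_forces_tree[OF k(2) assms(1)] k(1) show ?thesis by (meson of_nat_mono order_trans)
qed

section \<open>Client's potential\<close>

text \<open>The probability that Client gets all of \<open>F\<close> if each free edge went to him
  independently with probability \<open>p\<close>. It vanishes once a missing edge is no longer
  free.\<close>

definition chance :: "real \<Rightarrow> edge set \<Rightarrow> edge set \<Rightarrow> edge set \<Rightarrow> real" where
  "chance p U C F = (if F - C \<subseteq> U then p ^ card (F - C) else 0)"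

text \<open>If the offer misses the edges that \<open>F\<close> still lacks, no choice changes the
  chance. Otherwise at most one choice keeps \<open>F\<close> alive, and it raises the chance by the
  factor \<open>1 / p\<close>, which is the number of choices. So the average does not grow.\<close>

lemma sum_chance_le:
  assumes "finite F" "A \<subseteq> U" "card A = q + 1"
  defines "p \<equiv> 1 / real (q + 1)"
  shows "(\<Sum>e\<in>A. chance p (U - A) (insert e C) F) \<le> real (card A) * chance p U C F"
proof (cases "(F - C) \<inter> A = {}")
  case True
  have "chance p (U - A) (insert e C) F = chance p U C F" if "e \<in> A" for e
  proof -
    have "F - insert e C = F - C" using True that by auto
    moreover have "F - C \<subseteq> U - A \<longleftrightarrow> F - C \<subseteq> U" using True by auto
    ultimately show ?thesis by (simp add: chance_def)
  qed
  then show ?thesis by simp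
next
  case False
  then obtain a where a: "a \<in> F" "a \<notin> C" "a \<in> A" by auto
  have finA: "finite A" using assms(3) by (simp add: card_ge_0_finite)
  have zero: "chance p (U - A) (insert e C) F = 0" if "e \<noteq> a" for e
    using a that by (auto simp: chance_def)
  have "(\<Sum>e\<in>A. chance p (U - A) (insert e C) F) = chance p (U - A) (insert a C) F"
    using finA a(3) zero by (subst sum.remove[of _ a]) auto
  also have "\<dots> \<le> real (card A) * chance p U C F"
  proof (cases "F - insert a C \<subseteq> U - A")
    case True
    then have "F - C \<subseteq> U" using a assms(2) by auto
    moreover have "F - insert a C = F - C - {a}" by auto
    moreover have "card (F - C) = Suc (card (F - C - {a}))"
      using a assms(1) by (subst card_Suc_Diff1) auto
    ultimately show ?thesis using assms(3) by (simp add: chance_def p_def)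
  next
    case False
    then have "chance p (U - A) (insert a C) F = 0" by (simp add: chance_def)
    moreover have "0 \<le> chance p U C F" by (simp add: chance_def p_def)
    ultimately show ?thesis by simp
  qed
  finally show ?thesis .
qed

text \<open>Client takes the edge that minimises the total chance. The minimum is at most the
  average, so by \<open>sum_chance_le\<close> the total never grows, and each fully claimed member
  contributes 1 to it.\<close>

lemma client_potential_strategy:
  fixes q :: nat
  assumes fin: "\<And>F. F \<in> set Fs \<Longrightarrow> finite F"
  defines "p \<equiv> 1 / real (q + 1)"
  shows "\<exists>\<sigma>\<in>client_strategies n q. \<forall>\<tau>\<in>waiter_strategies n q. \<forall>k.
    real (length (filter (\<lambda>F. F \<subseteq> client_edges (play n q \<sigma> \<tau> k)) Fs)) \<le> (\<Sum>F\<leftarrow>Fs. p ^ card F)"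
proof -
  define pot where "pot h = (\<Sum>F\<leftarrow>Fs. chance p (unclaimed n h) (client_edges h) F)" for h
  define \<sigma> where "\<sigma> h A = arg_min_on (\<lambda>e. pot (h @ [(A, e)])) A" for h A
  have best: "\<sigma> h A \<in> A \<and> pot (h @ [(A, \<sigma> h A)]) \<le> pot h" if "legal_offer n q h A" for h A
  proof -
    have A: "A \<subseteq> unclaimed n h" "card A = q + 1" using that by (auto simp: legal_offer_def)
    then have finA: "finite A" "A \<noteq> {}" by (auto simp: card_ge_0_finite)
    have "real (card A) * pot (h @ [(A, \<sigma> h A)]) \<le> (\<Sum>e\<in>A. pot (h @ [(A, e)]))"
      unfolding \<sigma>_def using finA
      by (intro sum_bounded_below arg_min_least) auto
    also have "\<dots> = (\<Sum>F\<leftarrow>Fs. \<Sum>e\<in>A. chance p (unclaimed n h - A) (insert e (client_edges h)) F)"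
    proof -
      have "unclaimed n (h @ [(A, e)]) = unclaimed n h - A"
        "client_edges (h @ [(A, e)]) = insert e (client_edges h)" for e
        by (auto simp: unclaimed_def client_edges_def)
      then have "pot (h @ [(A, e)]) = (\<Sum>F\<leftarrow>Fs. chance p (unclaimed n h - A) (insert e (client_edges h)) F)" for e
        by (simp add: pot_def)
      then show ?thesis by (simp add: sum_list_sum_nth sum.swap[of _ _ A])
    qed
    also have "\<dots> \<le> (\<Sum>F\<leftarrow>Fs. real (card A) * chance p (unclaimed n h) (client_edges h) F)"
      unfolding p_def using A fin by (intro sum_list_mono sum_chance_le) auto
    also have "\<dots> = real (card A) * pot h" by (simp add: pot_def sum_list_const_mult)
    finally have "pot (h @ [(A, \<sigma> h A)]) \<le> pot h" using A by simp
    moreover have "\<sigma> h A \<in> A" unfolding \<sigma>_def by (rule arg_min_if_finite) (use finA in auto)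
    ultimately show ?thesis by blast
  qed
  then have \<sigma>: "\<sigma> \<in> client_strategies n q" by (auto simp: client_strategies_def)
  have "real (length (filter (\<lambda>F. F \<subseteq> client_edges (play n q \<sigma> \<tau> k)) Fs)) \<le> (\<Sum>F\<leftarrow>Fs. p ^ card F)"
    if \<tau>: "\<tau> \<in> waiter_strategies n q" for \<tau> k
  proof -
    let ?h = "play n q \<sigma> \<tau> k"
    have "real (length (filter (\<lambda>F. F \<subseteq> client_edges ?h) Fs)) =
        (\<Sum>F\<leftarrow>Fs. if F \<subseteq> client_edges ?h then 1 else 0)"
      by (induction Fs) auto
    also have "\<dots> \<le> pot ?h"
      unfolding pot_def
    proof (intro sum_list_mono)
      fix F
      have "card (F - client_edges ?h) = 0" if "F \<subseteq> client_edges ?h"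
        using that by (simp only: Diff_eq_empty_iff[THEN iffD2] card.empty)
      then show "(if F \<subseteq> client_edges ?h then 1 else 0) \<le> chance p (unclaimed n ?h) (client_edges ?h) F"
        by (auto simp: chance_def p_def)
    qed
    also have "\<dots> \<le> pot []"
    proof (induction k)
      case (Suc k)
      then show ?case
        using best[of "play n q \<sigma> \<tau> k" "\<tau> (play n q \<sigma> \<tau> k)"] \<tau>
        by (auto simp: Let_def waiter_strategies_def intro: order_trans)
    qed simp
    \<comment> \<open>Only an inequality, as members that are not sets of edges of the board start
      with chance 0.\<close>
    also have "\<dots> \<le> (\<Sum>F\<leftarrow>Fs. p ^ card F)"
      unfolding pot_def by (intro sum_list_mono) (auto simp: chance_def client_edges_def p_def)
    finally show ?thesis .
  qed
  then show ?thesis using \<sigma> by blast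
qed

section \<open>Branching trees\<close>

text \<open>\<open>U\<close> lists the vertices of the tree built so far, \<open>y\<close> is the end of the current path, and \<open>j\<close> is
  the number of times that the path may still be ended, by continuing at any vertex of \<open>U\<close>.
  Edge sets are listed with multiplicity, as the end points matter.\<close>

function branchings :: "nat \<Rightarrow> nat \<Rightarrow> nat list \<Rightarrow> nat \<Rightarrow> edge set list" where
  "branchings n 0 U y = [{}]"
| "branchings n (Suc j) U y = concat (map (branchings n j U) U) @
     concat (map (\<lambda>x. map (insert {y, x}) (branchings n (Suc j) (x # U) x))
       (filter (\<lambda>x. x \<notin> set U) [0..<n]))"
  by pat_completeness auto
termination
\<comment> \<open>Ending a path lowers \<open>j\<close>; extending it uses up a vertex outside
  \<open>U\<close>.\<close>
proof (relation "measures [\<lambda>(n, j, U, y). j, \<lambda>(n, j, U, y). card ({..<n} - set U)]")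
  fix n j :: nat and U :: "nat list" and y x :: nat
  assume "x \<in> set (filter (\<lambda>x. x \<notin> set U) [0..<n])"
  then have "{..<n} - set (x # U) \<subset> {..<n} - set U" by auto
  then have "card ({..<n} - set (x # U)) < card ({..<n} - set U)"
    by (intro psubset_card_mono) auto
  then show "((n, Suc j, x # U, x), n, Suc j, U, y)
    \<in> measures [\<lambda>(n, j, U, y). j, \<lambda>(n, j, U, y). card ({..<n} - set U)]" by simp
qed auto

declare branchings.simps(2) [simp del]

text \<open>Each edge contains a vertex that was new when the edge was added. Hence the edge
  \<open>{y, x}\<close> of a path step does not recur later, and the step multiplies the weight by
  exactly \<open>p\<close>.\<close>

lemma branchings_edges:
  assumes "F \<in> set (branchings n j U y)"
  shows "finite F \<and> (\<forall>e\<in>F. \<not> e \<subseteq> set U)"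
  using assms
proof (induction n j U y arbitrary: F rule: branchings.induct)
  case (1 n U y)
  then show ?case by simp
next
  case (2 n j U y)
  let ?new = "filter (\<lambda>x. x \<notin> set U) [0..<n]"
  have "set (branchings n (Suc j) U y) = (\<Union>z\<in>set U. set (branchings n j U z)) \<union>
      (\<Union>x\<in>set ?new. insert {y, x} ` set (branchings n (Suc j) (x # U) x))"
    by (subst branchings.simps) simp
  with 2(3) have "(\<exists>z\<in>set U. F \<in> set (branchings n j U z)) \<or>
      (\<exists>x\<in>set ?new. \<exists>F'\<in>set (branchings n (Suc j) (x # U) x). F = insert {y, x} F')"
    by (simp add: image_iff)
  then show ?case
  proof
    assume "\<exists>z\<in>set U. F \<in> set (branchings n j U z)"
    then show ?thesis using 2(1) by blast
  next
    assume "\<exists>x\<in>set ?new. \<exists>F'\<in>set (branchings n (Suc j) (x # U) x). F = insert {y, x} F'"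
    then obtain x F' where x: "x \<in> set ?new" and F': "F' \<in> set (branchings n (Suc j) (x # U) x)"
      and F: "F = insert {y, x} F'" by blast
    from 2(2)[OF x F'] have "finite F'" "\<forall>e\<in>F'. \<not> e \<subseteq> set U" by auto
    then show ?thesis using x by (simp add: F)
  qed
qed

lemma sum_list_map_concat:
  fixes f :: "'a \<Rightarrow> 'b :: comm_monoid_add"
  shows "(\<Sum>x\<leftarrow>concat xss. f x) = (\<Sum>xs\<leftarrow>xss. \<Sum>x\<leftarrow>xs. f x)"
  by (induction xss) auto

lemma branchings_Suc_weight:
  fixes p :: real
  assumes "y \<in> set U"
  shows "(\<Sum>F\<leftarrow>branchings n (Suc j) U y. p ^ card F) =
    (\<Sum>z\<leftarrow>U. \<Sum>F\<leftarrow>branchings n j U z. p ^ card F) +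
    (\<Sum>x\<leftarrow>filter (\<lambda>x. x \<notin> set U) [0..<n]. p * (\<Sum>F\<leftarrow>branchings n (Suc j) (x # U) x. p ^ card F))"
proof -
  have "card (insert {y, x} F) = Suc (card F)" if "F \<in> set (branchings n (Suc j) (x # U) x)" for x F
  proof -
    have "{y, x} \<subseteq> set (x # U)" using assms by auto
    with branchings_edges[OF that] have "{y, x} \<notin> F" "finite F" by blast+
    then show ?thesis by simp
  qed
  then have "(\<Sum>F\<leftarrow>branchings n (Suc j) (x # U) x. p ^ card (insert {y, x} F)) =
      p * (\<Sum>F\<leftarrow>branchings n (Suc j) (x # U) x. p ^ card F)" for x
    by (simp add: sum_list_const_mult[symmetric] cong: map_cong)
  then show ?thesis
    by (subst branchings.simps) (simp add: sum_list_map_concat o_def)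
qed

text \<open>Write \<open>m\<close> for the length of \<open>U\<close> and \<open>b\<close> for
  \<open>K / (\<delta> * \<eta>)\<close>. Ending the path gives a factor \<open>m\<close>, at most
  \<open>K / \<delta> * exp (\<delta> * m / K)\<close>; the exponential raises \<open>j\<close> by
  one in the exponent and \<open>K / \<delta>\<close> equals \<open>\<eta> * b\<close>. A path step
  raises \<open>m\<close> by one, which costs at most \<open>exp \<delta>\<close> because
  \<open>j \<le> K\<close>, so all steps together take the share \<open>1 - \<eta>\<close>.\<close>

lemma branchings_weight_le:
  fixes p \<delta> \<eta> :: real and K :: nat
  assumes "0 \<le> p" "0 < \<delta>" "0 < \<eta>" "real n * p * exp \<delta> \<le> 1 - \<eta>" "0 < K" "j \<le> K" "y \<in> set U"
  shows "(\<Sum>F\<leftarrow>branchings n j U y. p ^ card F) \<le>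
    (real K / (\<delta> * \<eta>)) ^ j * exp (\<delta> * j * length U / K)"
  using assms(4,6,7)
proof (induction n j U y rule: branchings.induct)
  case (1 n U y)
  then show ?case by simp
next
  case (2 n j U y)
  let ?w = "\<lambda>j U y. \<Sum>F\<leftarrow>branchings n j U y. p ^ card F"
  define b where "b = real K / (\<delta> * \<eta>)"
  define m where "m = length U"
  define X where "X = exp (\<delta> * Suc j * m / K)"
  have pos: "0 \<le> b" using assms by (simp add: b_def)
  have "(\<Sum>z\<leftarrow>U. ?w j U z) \<le> (\<Sum>z\<leftarrow>U. b ^ j * exp (\<delta> * j * m / K))"
    unfolding b_def m_def using 2 by (intro sum_list_mono 2(1)) auto
  also have "\<dots> = real m * (b ^ j * exp (\<delta> * j * m / K))"
    by (simp add: sum_list_triv m_def)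
  also have "\<dots> \<le> (K / \<delta> * exp (\<delta> * m / K)) * (b ^ j * exp (\<delta> * j * m / K))"
  proof (intro mult_right_mono)
    have "\<delta> * m / K \<le> exp (\<delta> * m / K)" using exp_ge_add_one_self[of "\<delta> * m / K"] by linarith
    then show "real m \<le> K / \<delta> * exp (\<delta> * m / K)"
      using assms by (simp add: field_simps)
  qed (use pos in auto)
  also have "\<dots> = \<eta> * b ^ Suc j * (exp (\<delta> * m / K) * exp (\<delta> * j * m / K))"
    using assms by (simp add: b_def)
  also have "exp (\<delta> * m / K) * exp (\<delta> * j * m / K) = X"
    by (simp add: X_def exp_add[symmetric] algebra_simps add_divide_distrib)
  finally have jump: "(\<Sum>z\<leftarrow>U. ?w j U z) \<le> \<eta> * b ^ Suc j * X" .
  have "(\<Sum>x\<leftarrow>filter (\<lambda>x. x \<notin> set U) [0..<n]. p * ?w (Suc j) (x # U) x) \<le>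
      (\<Sum>x\<leftarrow>filter (\<lambda>x. x \<notin> set U) [0..<n]. p * (b ^ Suc j * (X * exp \<delta>)))"
  proof (intro sum_list_mono mult_left_mono)
    fix x assume x: "x \<in> set (filter (\<lambda>x. x \<notin> set U) [0..<n])"
    have "?w (Suc j) (x # U) x \<le> b ^ Suc j * exp (\<delta> * Suc j * length (x # U) / K)"
      unfolding b_def using 2 by (intro 2(2)[OF x]) auto
    also have "exp (\<delta> * Suc j * length (x # U) / K) = X * exp (\<delta> * Suc j / K)"
      by (simp add: X_def m_def exp_add[symmetric] algebra_simps add_divide_distrib)
    also have "\<dots> \<le> X * exp \<delta>"
    proof -
      have "\<delta> * real (Suc j) \<le> \<delta> * real K" using assms(2) 2(4) by (intro mult_left_mono) auto
      then have "\<delta> * Suc j / K \<le> \<delta>" using assms(5) by (simp add: divide_le_eq)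
      then show ?thesis by (simp add: X_def)
    qed
    finally show "?w (Suc j) (x # U) x \<le> b ^ Suc j * (X * exp \<delta>)"
      using pos by (simp add: mult_left_mono)
  qed (use assms in auto)
  also have "\<dots> = real (length (filter (\<lambda>x. x \<notin> set U) [0..<n])) * (p * (b ^ Suc j * (X * exp \<delta>)))"
    by (simp add: sum_list_triv)
  also have "\<dots> \<le> real n * (p * (b ^ Suc j * (X * exp \<delta>)))"
  proof (intro mult_right_mono)
    show "real (length (filter (\<lambda>x. x \<notin> set U) [0..<n])) \<le> real n"
      using length_filter_le[of "\<lambda>x. x \<notin> set U" "[0..<n]"] by simp
  qed (use assms pos in \<open>auto simp: X_def\<close>)
  also have "\<dots> = (real n * p * exp \<delta>) * (b ^ Suc j * X)" by simp
  also have "\<dots> \<le> (1 - \<eta>) * (b ^ Suc j * X)"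
    using 2(3) pos by (intro mult_right_mono) (auto simp: X_def)
  finally have "?w (Suc j) U y \<le> \<eta> * b ^ Suc j * X + (1 - \<eta>) * (b ^ Suc j * X)"
    unfolding branchings_Suc_weight[OF 2(5)] using jump by linarith
  also have "\<dots> = b ^ Suc j * X" by (simp add: algebra_simps)
  finally show ?case by (simp add: b_def X_def m_def)
qed

section \<open>Counting branchings inside a component\<close>

text \<open>Only steps into \<open>U\<close> are forbidden, so the start \<open>y\<close> may itself
  lie in \<open>U\<close>.\<close>

definition reach_avoiding :: "edge set \<Rightarrow> nat set \<Rightarrow> nat \<Rightarrow> nat set" where
  "reach_avoiding E U y = {(a, b). {a, b} \<in> E \<and> b \<notin> U}\<^sup>* `` {y}"

lemma reach_avoiding_subset:
  assumes "linked E `` C \<subseteq> C" "y \<in> C"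
  shows "reach_avoiding E U y \<subseteq> C"
proof -
  have "z \<in> C" if "(y, z) \<in> {(a, b). {a, b} \<in> E \<and> b \<notin> U}\<^sup>*" for z
    using that by induction (use assms in \<open>auto simp: linked_def\<close>)
  then show ?thesis by (auto simp: reach_avoiding_def)
qed

text \<open>Loops are cut out: a walk that comes back to \<open>y\<close> or to its first vertex
  \<open>x\<close> is restarted there. The inclusion mirrors the path step of
  \<open>branchings\<close>.\<close>

lemma reach_avoiding_step:
  "reach_avoiding E U y \<subseteq> insert y (\<Union>x\<in>{x. {y, x} \<in> E \<and> x \<notin> U}. reach_avoiding E (insert x U) x)"
proof -
  have "z = y \<or> (\<exists>x. {y, x} \<in> E \<and> x \<notin> U \<and> z \<in> reach_avoiding E (insert x U) x)"
    if "(y, z) \<in> {(a, b). {a, b} \<in> E \<and> b \<notin> U}\<^sup>*" for z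
    using that
  proof (induction rule: rtrancl_induct)
    case (step w z)
    show ?case
    proof (cases "w = y \<or> z = y")
      case True
      then show ?thesis using step(2) by (auto simp: reach_avoiding_def)
    next
      case False
      then obtain x where x: "{y, x} \<in> E" "x \<notin> U" "w \<in> reach_avoiding E (insert x U) x"
        using step(3) by blast
      have "z \<in> reach_avoiding E (insert x U) x"
      proof (cases "z = x")
        case False
        then show ?thesis
          using x(3) step(2) by (auto simp: reach_avoiding_def intro: rtrancl_into_rtrancl)
      qed (simp add: reach_avoiding_def)
      then show ?thesis using x by blast
    qed
  qed simp
  then show ?thesis by (auto simp: reach_avoiding_def)
qed

text \<open>Cut the walk at its last visit to \<open>U\<close>.\<close>

lemma reach_avoiding_cover:
  assumes "(u, z) \<in> (linked E)\<^sup>*" "u \<in> U"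
  shows "\<exists>y\<in>U. z \<in> reach_avoiding E U y"
  using assms(1)
proof (induction rule: rtrancl_induct)
  case base
  show ?case using assms(2) by (auto simp: reach_avoiding_def)
next
  case (step w z)
  show ?case
  proof (cases "z \<in> U")
    case True
    then show ?thesis by (auto simp: reach_avoiding_def)
  next
    case False
    from step(3) obtain y where y: "y \<in> U" "w \<in> reach_avoiding E U y" ..
    moreover have "(w, z) \<in> {(a, b). {a, b} \<in> E \<and> b \<notin> U}"
      using False step(2) by (simp add: linked_def)
    ultimately have "z \<in> reach_avoiding E U y"
      unfolding reach_avoiding_def Image_singleton_iff by (blast intro: rtrancl_into_rtrancl)
    then show ?thesis using y(1) ..
  qed
qed

definition claimed_branchings :: "nat \<Rightarrow> edge set \<Rightarrow> nat \<Rightarrow> nat list \<Rightarrow> nat \<Rightarrow> nat" where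
  "claimed_branchings n E j U y = length (filter (\<lambda>F. F \<subseteq> E) (branchings n j U y))"

lemma claimed_branchings_Suc:
  "claimed_branchings n E (Suc j) U y =
    (\<Sum>z\<leftarrow>U. claimed_branchings n E j U z) +
    (\<Sum>x\<leftarrow>filter (\<lambda>x. x \<notin> set U) [0..<n].
      if {y, x} \<in> E then claimed_branchings n E (Suc j) (x # U) x else 0)"
proof -
  have "length (filter (\<lambda>F. F \<subseteq> E) (map (insert e) Fs)) =
      (if e \<in> E then length (filter (\<lambda>F. F \<subseteq> E) Fs) else 0)" for e and Fs :: "edge set list"
    by (induction Fs) auto
  then show ?thesis
    unfolding claimed_branchings_def
    by (subst branchings.simps) (simp add: filter_concat length_concat o_def)
qed

text \<open>Every vertex of \<open>C\<close> can be the end of the next path, which starts at some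
  vertex of \<open>U\<close>. The enlarged tree still lies in \<open>C\<close>, so by induction it
  admits \<open>card C ^ j\<close> continuations. This is why \<open>U\<close> is arbitrary in the
  induction.\<close>

lemma claimed_branchings_ge:
  assumes E: "E \<subseteq> complete_edges n" and C: "C \<subseteq> {..<n}" "linked E `` C \<subseteq> C" "C \<times> C \<subseteq> (linked E)\<^sup>*"
    and U: "set U \<subseteq> C" "distinct U" "U \<noteq> []"
  shows "card C ^ j \<le> (\<Sum>y\<leftarrow>U. claimed_branchings n E j U y)"
  using U
proof (induction j arbitrary: U)
  case 0
  then show ?case by (cases U) (auto simp: claimed_branchings_def)
next
  case (Suc j)
  have finC: "finite C" using C(1) finite_subset by blast
  have finR: "finite (reach_avoiding E V x)" if "x \<in> C" for V x
    using reach_avoiding_subset[OF C(2) that] finC finite_subset by blast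
  \<comment> \<open>Each vertex reachable from \<open>y\<close> off the tree contributes
    \<open>card C ^ j\<close>; the induction is on the vertices of \<open>C\<close> not yet
    used.\<close>
  have reach: "card (reach_avoiding E (set U) y) * card C ^ j \<le> claimed_branchings n E (Suc j) U y"
    if "set U \<subseteq> C" "distinct U" "y \<in> set U" for U y
    using that
  proof (induction "card (C - set U)" arbitrary: U y rule: less_induct)
    case less
    let ?X = "{x. {y, x} \<in> E \<and> x \<notin> set U}"
    let ?c = "card C ^ j"
    have yC: "y \<in> C" using less.prems by auto
    have XC: "?X \<subseteq> C" using C(2) yC by (auto simp: linked_def)
    then have finX: "finite ?X" using finC finite_subset by blast
    have "card (reach_avoiding E (set U) y) \<le>
        card (insert y (\<Union>x\<in>?X. reach_avoiding E (insert x (set U)) x))"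
      using finX finR XC by (intro card_mono reach_avoiding_step) auto
    also have "\<dots> \<le> Suc (card (\<Union>x\<in>?X. reach_avoiding E (insert x (set U)) x))"
      using card_Un_le[of "{y}" "\<Union>x\<in>?X. reach_avoiding E (insert x (set U)) x"] by simp
    also have "\<dots> \<le> Suc (\<Sum>x\<in>?X. card (reach_avoiding E (insert x (set U)) x))"
      using card_UN_le[OF finX] by simp
    finally have "card (reach_avoiding E (set U) y) * ?c \<le>
        Suc (\<Sum>x\<in>?X. card (reach_avoiding E (insert x (set U)) x)) * ?c"
      by (rule mult_le_mono1)
    also have "\<dots> = ?c + (\<Sum>x\<in>?X. card (reach_avoiding E (insert x (set U)) x) * ?c)"
      by (simp add: sum_distrib_right)
    also have "\<dots> \<le> ?c + (\<Sum>x\<in>?X. claimed_branchings n E (Suc j) (x # U) x)"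
    proof (intro add_left_mono sum_mono)
      fix x assume x: "x \<in> ?X"
      then have "C - set (x # U) \<subset> C - set U" using XC by auto
      then have "card (C - set (x # U)) < card (C - set U)" using finC by (intro psubset_card_mono) auto
      from less.hyps[OF this, of x] show "card (reach_avoiding E (insert x (set U)) x) * ?c \<le>
          claimed_branchings n E (Suc j) (x # U) x" using less.prems x XC by auto
    qed
    \<comment> \<open>The term for ending the path at \<open>y\<close> itself.\<close>
    also have "?c \<le> (\<Sum>z\<leftarrow>U. claimed_branchings n E j U z)"
      using less.prems by (intro Suc.IH) auto
    also have "(\<Sum>x\<in>?X. claimed_branchings n E (Suc j) (x # U) x) =
        (\<Sum>x\<leftarrow>filter (\<lambda>x. x \<notin> set U) [0..<n].
          if {y, x} \<in> E then claimed_branchings n E (Suc j) (x # U) x else 0)"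
    proof -
      have "?X = {x \<in> set (filter (\<lambda>x. x \<notin> set U) [0..<n]). {y, x} \<in> E}"
        using XC C(1) by auto
      then show ?thesis
        by (simp add: sum_list_distinct_conv_sum_set sum.inter_filter[symmetric])
    qed
    finally show ?case by (simp add: claimed_branchings_Suc)
  qed
  obtain u where u: "u \<in> set U" using Suc.prems(3) by (cases U) auto
  have "C \<subseteq> (\<Union>y\<in>set U. reach_avoiding E (set U) y)"
    using C(3) u Suc.prems(1) reach_avoiding_cover[of u _ E "set U"] by blast
  then have "card C \<le> card (\<Union>y\<in>set U. reach_avoiding E (set U) y)"
    using finR Suc.prems(1) by (intro card_mono) auto
  also have "\<dots> \<le> (\<Sum>y\<in>set U. card (reach_avoiding E (set U) y))" by (rule card_UN_le) simp
  finally have "card C ^ Suc j \<le> (\<Sum>y\<in>set U. card (reach_avoiding E (set U) y)) * card C ^ j"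
    by simp
  also have "\<dots> \<le> (\<Sum>y\<in>set U. claimed_branchings n E (Suc j) U y)"
    unfolding sum_distrib_right using Suc.prems by (intro sum_mono reach) auto
  also have "\<dots> = (\<Sum>y\<leftarrow>U. claimed_branchings n E (Suc j) U y)"
    using Suc.prems(2) by (simp add: sum_list_distinct_conv_sum_set)
  finally show ?case .
qed

lemma component_card_power_le:
  assumes E: "E \<subseteq> complete_edges n" and "v < n"
  shows "card ((linked E)\<^sup>* `` {v}) ^ j \<le> claimed_branchings n E j [v] v"
proof -
  let ?C = "(linked E)\<^sup>* `` {v}"
  have "?C \<subseteq> {..<n}" using complete_edges_reach[OF E] assms(2) by auto
  moreover have "linked E `` ?C \<subseteq> ?C" by (auto intro: rtrancl_into_rtrancl)
  moreover have "?C \<times> ?C \<subseteq> (linked E)\<^sup>*"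
    using sym_rtrancl[OF sym_linked] by (auto dest: symD intro: rtrancl_trans)
  ultimately show ?thesis using claimed_branchings_ge[OF E, of ?C "[v]" j] by simp
qed

section \<open>Client's bound\<close>

lemma client_bound:
  assumes "3 \<le> n" "0 < \<epsilon>" "\<epsilon> < 1" "(1 + \<epsilon>) * real n \<le> real q"
  shows "\<exists>\<sigma>\<in>client_strategies n q. \<forall>\<tau>\<in>waiter_strategies n q.
    real (outcome n q \<sigma> \<tau>) \<le> 32 * exp 2 * \<epsilon> powi (-2) * ln (real n)"
proof -
  \<comment> \<open>With \<open>K\<close> at least \<open>ln n\<close>, the factor \<open>n\<close>
    for the choice of the root costs only a factor \<open>e\<close> after taking \<open>K\<close>-th
    roots.\<close>
  define K where "K = nat \<lceil>ln (real n)\<rceil>"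
  \<comment> \<open>This value serves as both \<delta> and \<eta> in
    \<open>branchings_weight_le\<close>. It works because \<open>(1 + \<epsilon> / 2) / (1 +
    \<epsilon>) \<le> 1 - \<epsilon> / 4\<close> for \<epsilon> below 1.\<close>
  define \<delta> where "\<delta> = \<epsilon> / 4"
  define p where "p = 1 / real (q + 1)"
  define b where "b = real K / (\<delta> * \<delta>)"
  define Fs where "Fs = concat (map (\<lambda>v. branchings n K [v] v) [0..<n])"
  \<comment> \<open>Since \<open>n\<close> is at least 3, \<open>ln n\<close> is at least 1 and
    rounding it up at most doubles it.\<close>
  have "exp 1 \<le> real n" using exp_le assms(1) by linarith
  then have ln1: "1 \<le> ln (real n)" using assms(1) by (simp add: ln_ge_iff)
  then have K: "1 \<le> real K" "ln (real n) \<le> real K" "real K \<le> 2 * ln (real n)"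
    unfolding K_def by linarith+
  have \<delta>: "0 < \<delta>" "\<delta> \<le> 1" using assms by (auto simp: \<delta>_def)
  have "real n * p \<le> 1 / (1 + \<epsilon>)"
    using assms by (simp add: p_def field_simps)
  moreover have "exp \<delta> \<le> 1 + \<epsilon> / 2"
    using exp_bound_lemma[of \<delta>] assms by (simp add: \<delta>_def)
  ultimately have "real n * p * exp \<delta> \<le> 1 / (1 + \<epsilon>) * (1 + \<epsilon> / 2)"
    using assms by (intro mult_mono) auto
  also have "\<dots> \<le> 1 - \<delta>"
  proof -
    have "1 + \<epsilon> / 2 \<le> (1 - \<delta>) * (1 + \<epsilon>)"
    proof -
      have "\<epsilon> * \<epsilon> \<le> \<epsilon> * 1" using assms by (intro mult_left_mono) auto
      then show ?thesis by (simp add: \<delta>_def field_simps)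
    qed
    then show ?thesis using assms by (simp add: divide_le_eq)
  qed
  finally have np: "real n * p * exp \<delta> \<le> 1 - \<delta>" .
  have "(\<Sum>F\<leftarrow>Fs. p ^ card F) = (\<Sum>v\<leftarrow>[0..<n]. \<Sum>F\<leftarrow>branchings n K [v] v. p ^ card F)"
    by (simp add: Fs_def sum_list_map_concat o_def)
  also have "\<dots> \<le> (\<Sum>v\<leftarrow>[0..<n]. b ^ K * exp \<delta>)"
  proof (intro sum_list_mono)
    fix v
    show "(\<Sum>F\<leftarrow>branchings n K [v] v. p ^ card F) \<le> b ^ K * exp \<delta>"
      using branchings_weight_le[of p \<delta> \<delta> n K K v "[v]"] \<delta> np K(1)
      by (simp add: p_def b_def)
  qed
  also have "\<dots> = real n * exp \<delta> * b ^ K" by (simp add: sum_list_triv)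
  also have "\<dots> \<le> (exp K * exp K) * b ^ K"
  proof (intro mult_right_mono mult_mono)
    have "real n = exp (ln (real n))" using assms(1) by simp
    also have "\<dots> \<le> exp K" using K(2) by simp
    finally show "real n \<le> exp K" .
    show "exp \<delta> \<le> exp (real K)" using K(1) \<delta> by simp
  qed (auto simp: b_def)
  also have "\<dots> = (exp 2 * b) ^ K"
    by (simp add: power_mult_distrib exp_add[symmetric] exp_of_nat_mult[symmetric])
  finally have weight: "(\<Sum>F\<leftarrow>Fs. p ^ card F) \<le> (exp 2 * b) ^ K" .
  have fin: "finite F" if "F \<in> set Fs" for F using that branchings_edges by (auto simp: Fs_def)
  from client_potential_strategy[of Fs n q, OF fin] obtain \<sigma> where \<sigma>: "\<sigma> \<in> client_strategies n q"
    and few: "\<And>\<tau> k. \<tau> \<in> waiter_strategies n q \<Longrightarrow>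
      real (length (filter (\<lambda>F. F \<subseteq> client_edges (play n q \<sigma> \<tau> k)) Fs)) \<le> (\<Sum>F\<leftarrow>Fs. p ^ card F)"
    unfolding p_def by blast
  have "real (outcome n q \<sigma> \<tau>) \<le> 32 * exp 2 * \<epsilon> powi (-2) * ln (real n)"
    if \<tau>: "\<tau> \<in> waiter_strategies n q" for \<tau>
  proof -
    define E where "E = final_graph n q \<sigma> \<tau>"
    have E: "E \<subseteq> complete_edges n"
      using client_edges_play[OF \<tau> \<sigma>] by (simp add: E_def final_graph_def)
    have "outcome n q \<sigma> \<tau> \<in> (\<lambda>v. card ((linked E)\<^sup>* `` {v})) ` {..<n}"
      unfolding outcome_eq[OF \<tau> \<sigma>] E_def using assms(1) by (intro Max_in) (auto simp: lessThan_empty_iff)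
    then obtain v where v: "v < n" "outcome n q \<sigma> \<tau> = card ((linked E)\<^sup>* `` {v})" by auto
    have "outcome n q \<sigma> \<tau> ^ K \<le> claimed_branchings n E K [v] v"
      unfolding v(2) by (rule component_card_power_le[OF E v(1)])
    also have "\<dots> \<le> (\<Sum>v\<leftarrow>[0..<n]. claimed_branchings n E K [v] v)"
      using v(1) by (intro member_le_sum_list) auto
    also have "\<dots> = length (filter (\<lambda>F. F \<subseteq> E) Fs)"
      by (simp add: Fs_def claimed_branchings_def filter_concat length_concat o_def)
    finally have "real (outcome n q \<sigma> \<tau>) ^ K \<le> real (length (filter (\<lambda>F. F \<subseteq> E) Fs))"
      by (metis of_nat_le_iff of_nat_power)
    also have "\<dots> \<le> (exp 2 * b) ^ K"
      using few[OF \<tau>] weight unfolding E_def final_graph_def by (blast intro: order_trans)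
    \<comment> \<open>The \<open>K\<close>-th root is taken here. Then
      \<open>1 / (\<delta> * \<delta>)\<close> supplies 16 and the rounding in \<open>K\<close>
      another factor 2.\<close>
    finally have "real (outcome n q \<sigma> \<tau>) \<le> exp 2 * b"
      using K(1) by (subst (asm) power_mono_iff) (auto simp: b_def)
    also have "\<dots> = 16 * exp 2 * \<epsilon> powi (-2) * real K"
      using assms by (simp add: b_def \<delta>_def power_int_minus field_simps power2_eq_square)
    also have "\<dots> \<le> 16 * exp 2 * \<epsilon> powi (-2) * (2 * ln (real n))"
      using K(3) assms by (intro mult_left_mono) auto
    finally show ?thesis by simp
  qed
  then show ?thesis using \<sigma> by blast
qed

theorem theorem1p1:
  "\<exists>c :: real. \<forall>\<^sub>F n :: nat in sequentially. \<forall>(\<epsilon> :: real) (q :: nat).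
     0 < \<epsilon> \<and> \<epsilon> < 1 \<and> 0 < q \<longrightarrow>
     (real q \<ge> (1 + \<epsilon>) * real n \<longrightarrow>
        (\<exists>\<sigma>\<in>client_strategies n q. \<forall>\<tau>\<in>waiter_strategies n q.
           real (outcome n q \<sigma> \<tau>) \<le> c * \<epsilon> powi (-2) * ln (real n)) \<and>
        real (game_value n q) \<le> c * \<epsilon> powi (-2) * ln (real n)) \<and>
     (real q \<le> (1 - \<epsilon>) * real n \<longrightarrow>
        (\<exists>\<tau>\<in>waiter_strategies n q. \<forall>\<sigma>\<in>client_strategies n q.
           real (outcome n q \<sigma> \<tau>) \<ge> min (real n) (2 * \<epsilon> * real n - 2)) \<and>
        real (game_value n q) \<ge> min (real n) (2 * \<epsilon> * real n - 2))"
proof (rule exI[of _ "32 * exp 2"], rule eventually_sequentiallyI[of 3],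
    intro allI impI conjI)
  fix n q :: nat and \<epsilon> :: real
  assume n: "3 \<le> n" and \<epsilon>: "0 < \<epsilon> \<and> \<epsilon> < 1 \<and> 0 < q"
  {
    assume "real q \<ge> (1 + \<epsilon>) * real n"
    with n \<epsilon> show client: "\<exists>\<sigma>\<in>client_strategies n q. \<forall>\<tau>\<in>waiter_strategies n q.
        real (outcome n q \<sigma> \<tau>) \<le> 32 * exp 2 * \<epsilon> powi (-2) * ln (real n)"
      by (intro client_bound) auto
    then show "real (game_value n q) \<le> 32 * exp 2 * \<epsilon> powi (-2) * ln (real n)"
      using game_value_le by blast
  next
    assume "real q \<le> (1 - \<epsilon>) * real n"
    with n show waiter: "\<exists>\<tau>\<in>waiter_strategies n q. \<forall>\<sigma>\<in>client_strategies n q.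
        min (real n) (2 * \<epsilon> * real n - 2) \<le> real (outcome n q \<sigma> \<tau>)"
      by (intro waiter_bound) auto
    then show "min (real n) (2 * \<epsilon> * real n - 2) \<le> real (game_value n q)"
      using n game_value_ge[of _ n q] by fastforce
  }
qed

end
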